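(* The radius of convexity of the class $\mathcal{M}(1)$ is $2-\sqrt3$. Moreover, the bound $2-\sqrt3$ is sharp, i.e. it cannot be replaced by any larger number.
   Context: $\mathbb{D}=\{z\in\mathbb{C}:|z|<1\}$. $\mathcal{M}(1)$ is the set of all harmonic functions $f=h+\overline{g}$ in $\mathbb{D}$, with $h(z)=z+\sum_{n\ge2}a_nz^n$ and $g(z)=\sum_{n\ge1}b_nz^n$ analytic in $\mathbb{D}$, such that $g'(z)=zh'(z)$ and $\operatorname{Re}\left(1+\frac{zh''(z)}{h'(z)}\right)>-\frac12$ for all $z\in\mathbb{D}$ (in particular $h'$ has no zeros in $\mathbb{D}$). The radius of convexity of a class of harmonic functions in $\mathbb{D}$ is the largest number $r_0\in(0,1]$ such that for every $0<r\le r_0$ every function in the class maps the disk $|z|<r$ onto a convex domain. *)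

theory Defs
  imports "HOL-Complex_Analysis.Complex_Analysis"
begin

text \<open>
  Functions on the open unit disk are represented by total functions on the complex plane;
  values outside the disk are unconstrained.  The condition that the derivative of \<open>h\<close> has no
  zeros is stated explicitly because division by zero yields zero in HOL, so the inequality
  alone would hold at such a point.
\<close>

definition class_M1 :: "(complex \<Rightarrow> complex) set" where
  "class_M1 = {f. \<exists>h g :: complex \<Rightarrow> complex. \<exists>a b :: nat \<Rightarrow> complex.
     h holomorphic_on ball 0 1 \<and> g holomorphic_on ball 0 1 \<and>
     (\<forall>z\<in>ball 0 1.
        f z = h z + cnj (g z) \<and>
        (\<lambda>n. a (n + 2) * z ^ (n + 2)) sums (h z - z) \<and>
        (\<lambda>n. b (n + 1) * z ^ (n + 1)) sums g z \<and>
        deriv g z = z * deriv h z \<and>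
        deriv h z \<noteq> 0 \<and>
        Re (1 + z * deriv (deriv h) z / deriv h z) > - 1 / 2)}"

definition convex_domain :: "complex set \<Rightarrow> bool" where
  "convex_domain S \<longleftrightarrow> S \<noteq> {} \<and> open S \<and> connected S \<and> convex S"

definition convexity_bound :: "(complex \<Rightarrow> complex) set \<Rightarrow> real \<Rightarrow> bool" where
  "convexity_bound F \<rho> \<longleftrightarrow> 0 < \<rho> \<and> \<rho> \<le> 1 \<and>
     (\<forall>r. 0 < r \<and> r \<le> \<rho> \<longrightarrow> (\<forall>f\<in>F. convex_domain (f ` ball 0 r)))"

text \<open>
  The largest bound is a relation, so that its existence is part of any claim about it.
\<close>

definition is_radius_of_convexity :: "(complex \<Rightarrow> complex) set \<Rightarrow> real \<Rightarrow> bool" where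
  "is_radius_of_convexity F r0 \<longleftrightarrow>
     convexity_bound F r0 \<and> (\<forall>\<rho>. convexity_bound F \<rho> \<longrightarrow> \<rho> \<le> r0)"

end

theory Submission
  imports Defs
begin

text \<open>
  A point \<open>z = r exp (\<i> t)\<close> of the circle of radius \<open>r < 1\<close> is mapped by \<open>f = h + cnj g\<close> to a point of
  a closed curve with outer normal \<open>n = z h' - cnj (z\<^sup>2 h')\<close>.  With \<open>P = 1 + z h'' / h'\<close>, the
  argument of \<open>n\<close> changes at a rate whose sign is that of
  \<open>r\<^sup>2 |h'|\<^sup>2 ((1 - r\<^sup>2) Re P - r\<^sup>2) + Re (z\<^sup>3 h'\<^sup>2)\<close>.  Two estimates bound this from below: the last
  term is at least \<open>- r\<^sup>3 |h'|\<^sup>2\<close>, and the condition \<open>Re P > - 1 / 2\<close> with \<open>P = 1\<close> at the origin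
  gives \<open>Re P \<ge> (1 - 2 r) / (1 + r)\<close> by the Schwarz lemma
  (\<open>Re_convexity_quotient_ge\<close>).  Together they make the rate nonnegative as soon as
  \<open>1 - 4 r + r\<^sup>2 \<ge> 0\<close>, that is, for \<open>r \<le> 2 - sqrt 3\<close> (\<open>turning_rate_nonneg\<close>).

  To get from turning to convexity of the image of the disk, note that the normal turns exactly once
  around the circle.  Hence the whole image curve lies on one side of each of its tangents
  (\<open>turning_once_tangent_supports\<close>, \<open>normal_supports_circle_image\<close>), and by the maximum principle
  so does the image of the disk.  An open image of a disk that is supported at every boundary value
  fills the intersection of the supporting half-planes (\<open>convex_image_if_support_planes\<close>), and
  the image is open because \<open>|g'| < |h'|\<close>.

  For sharpness, both estimates are equalities at \<open>z = - r\<close> for the function with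
  \<open>h' z = 1 / (1 - z) ^ 3\<close>.  Its image of the disk is dented at the image of \<open>- r\<close> when
  \<open>1 - 4 r + r\<^sup>2 < 0\<close>, and the dent is exhibited by two conjugate points
  (\<open>extremal_image_not_convex\<close>).
\<close>

section \<open>Supporting half-planes and open harmonic maps\<close>

text \<open>
  The open half-spaces given by the normals intersect in a convex set \<open>K\<close> that contains the image.
  The image is closed in \<open>K\<close>, because the only other points of the compact set \<open>f ` cball a r\<close> are
  values on the sphere, and these lie on a bounding hyperplane and hence outside \<open>K\<close>.  It is also
  open, and \<open>K\<close> is connected, so the image is all of \<open>K\<close>.
\<close>

lemma convex_image_if_support_planes:
  fixes f :: "'a::euclidean_space \<Rightarrow> 'b::euclidean_space"
  assumes r: "0 < r"
    and cont: "continuous_on (cball a r) f"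
    and op: "open (f ` ball a r)"
    and supp: "\<And>z. z \<in> sphere a r \<Longrightarrow> \<exists>n. n \<noteq> 0 \<and> (\<forall>y\<in>ball a r. n \<bullet> f y \<le> n \<bullet> f z)"
  shows "convex (f ` ball a r)"
proof -
  obtain n where n0: "\<And>z. z \<in> sphere a r \<Longrightarrow> n z \<noteq> 0"
    and n: "\<And>z y. z \<in> sphere a r \<Longrightarrow> y \<in> ball a r \<Longrightarrow> n z \<bullet> f y \<le> n z \<bullet> f z"
    using supp by metis
  define K where "K = (\<Inter>z\<in>sphere a r. {p. n z \<bullet> p < n z \<bullet> f z})"
  have convK: "convex K"
    unfolding K_def by (intro convex_INT convex_halfspace_lt)
  have sub: "f ` ball a r \<subseteq> K"
    unfolding K_def
  proof (rule INT_greatest)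
    fix z assume z: "z \<in> sphere a r"
    have "f ` ball a r \<subseteq> {p. n z \<bullet> p \<le> n z \<bullet> f z}"
      using n[OF z] by auto
    then have "f ` ball a r \<subseteq> interior {p. n z \<bullet> p \<le> n z \<bullet> f z}"
      using op by (rule interior_maximal)
    then show "f ` ball a r \<subseteq> {p. n z \<bullet> p < n z \<bullet> f z}"
      by (simp add: interior_halfspace_le n0[OF z])
  qed
  have "K \<inter> f ` cball a r \<subseteq> f ` ball a r"
  proof
    fix p assume p: "p \<in> K \<inter> f ` cball a r"
    then obtain z where z: "z \<in> cball a r" "p = f z" by auto
    have "z \<notin> sphere a r"
      using p z by (auto simp: K_def)
    then show "p \<in> f ` ball a r"
      using z by (auto simp: less_le)
  qed
  then have eq: "f ` ball a r = K \<inter> f ` cball a r"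
    using sub by (auto simp: less_imp_le)
  have "closed (f ` cball a r)"
    using cont by (simp add: compact_continuous_image compact_imp_closed)
  then have cl: "closedin (top_of_set K) (f ` ball a r)"
    unfolding eq by (rule closedin_closed_Int)
  have "openin (top_of_set K) (f ` ball a r)"
    using op sub by (rule open_subset[rotated])
  moreover have "f ` ball a r \<noteq> {}"
    using r by auto
  ultimately have "f ` ball a r = K"
    using cl convex_connected[OF convK] unfolding connected_clopen by blast
  then show ?thesis
    using convK by simp
qed

text \<open>
  The real derivative \<open>v \<mapsto> A v + cnj (B v)\<close> of \<open>h + cnj g\<close> has determinant
  \<open>|A|\<^sup>2 - |B|\<^sup>2\<close>, with \<open>A\<close> and \<open>B\<close> the complex derivatives of \<open>h\<close> and \<open>g\<close>.  When this is positive, its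
  inverse is \<open>u \<mapsto> (cnj A u - cnj B cnj u) / (|A|\<^sup>2 - |B|\<^sup>2)\<close>, and a map with right-invertible
  derivatives is open.
\<close>

lemma open_image_sense_preserving_harmonic:
  fixes h g :: "complex \<Rightarrow> complex"
  assumes S: "open S" and h: "h holomorphic_on S" and g: "g holomorphic_on S"
    and jac: "\<And>z. z \<in> S \<Longrightarrow> norm (deriv g z) < norm (deriv h z)"
  shows "open ((\<lambda>z. h z + cnj (g z)) ` S)"
proof -
  let ?f = "\<lambda>z. h z + cnj (g z)"
  have "?f z \<in> interior (?f ` S)" if z: "z \<in> S" for z
  proof -
    define A B where "A = deriv h z" and "B = deriv g z"
    define J where "J = A * cnj A - B * cnj B"
    have J: "J \<noteq> 0"
    proof -
      have "(norm B)\<^sup>2 < (norm A)\<^sup>2"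
        using jac[OF z] by (simp add: A_def B_def power_strict_mono)
      then show ?thesis
        unfolding J_def complex_norm_square [symmetric]
        by (metis less_irrefl of_real_eq_iff right_minus_eq)
    qed
    have cJ: "cnj J = J"
      by (simp add: J_def mult.commute)
    define D where "D = (\<lambda>v. A * v + cnj (B * v))"
    define D' where "D' = (\<lambda>u. (cnj A * u - cnj B * cnj u) / J)"
    have "(h has_derivative (\<lambda>v. A * v)) (at z)" "(g has_derivative (\<lambda>v. B * v)) (at z)"
      using holomorphic_derivI[OF h S z] holomorphic_derivI[OF g S z]
      by (simp_all add: has_field_derivative_def A_def B_def)
    then have der: "(?f has_derivative D) (at z)"
      unfolding D_def by (intro has_derivative_add has_derivative_cnj)
    have "bounded_linear D'"
      unfolding D'_def
      by (intro bounded_linear_divide[THEN bounded_linear_compose] bounded_linear_sub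
          bounded_linear_const_mult bounded_linear_ident bounded_linear_cnj)
    moreover have "D \<circ> D' = id"
    proof
      fix u
      have "D (D' u) = (A * (cnj A * u - cnj B * cnj u) + cnj B * (A * cnj u - B * u)) / J"
        by (simp add: D_def D'_def cJ add_divide_distrib)
      also have "\<dots> = u"
        using J by (simp add: J_def field_simps)
      finally show "(D \<circ> D') u = id u" by simp
    qed
    moreover have "continuous_on S ?f"
      using h g by (intro continuous_intros holomorphic_on_imp_continuous_on)
    ultimately show ?thesis
      using sussmann_open_mapping[OF S _ z der, of D' S] S z
      by (simp add: interior_open)
  qed
  then have "interior (?f ` S) = ?f ` S"
    by (intro subset_antisym interior_subset image_subsetI)
  then show ?thesis
    by (simp add: interior_eq)
qed

section \<open>The lower bound for the convexity quotient\<close>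

text \<open>
  The Cayley transform \<open>w = (p - 1) / (p + 1)\<close> maps the right half-plane to the unit disk and \<open>p 0\<close>
  to \<open>0\<close>, so the Schwarz lemma gives \<open>|w z| \<le> |z|\<close>; transforming back yields Harnack's bound.
\<close>

lemma Re_ge_of_Re_pos:
  assumes p: "p holomorphic_on ball 0 1" and p0: "p 0 = 1"
    and pos: "\<And>z. z \<in> ball 0 1 \<Longrightarrow> 0 < Re (p z)" and z: "norm z < 1"
  shows "(1 - norm z) / (1 + norm z) \<le> Re (p z)"
proof -
  define w where "w = (\<lambda>z. (p z - 1) / (p z + 1))"
  have nz: "p y + 1 \<noteq> 0" if "y \<in> ball 0 1" for y
    using pos[OF that] by (auto simp: complex_eq_iff)
  have "w holomorphic_on ball 0 1"
    unfolding w_def using nz by (intro holomorphic_intros p)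
  moreover have "w 0 = 0"
    by (simp add: w_def p0)
  moreover have less: "norm (w y) < 1" if "norm y < 1" for y
  proof -
    have "(norm (p y - 1))\<^sup>2 < (norm (p y + 1))\<^sup>2"
      using pos[of y] that by (simp add: cmod_power2) (simp add: power2_eq_square algebra_simps)
    then have "norm (p y - 1) < norm (p y + 1)"
      by (rule power_less_imp_less_base) simp
    then show ?thesis
      by (simp add: w_def norm_divide divide_less_eq)
  qed
  ultimately have le: "norm (w z) \<le> norm z"
    using Schwarz_Lemma(1) z by blast
  have zb: "z \<in> ball 0 1" using z by simp
  have pw: "p z * (1 - w z) = 1 + w z"
    using nz[OF zb] by (simp add: w_def field_simps)
  have w1: "1 - w z \<noteq> 0"
    using less[OF z] by auto
  have "p z = (1 + w z) / (1 - w z)"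
    using pw w1 by (simp add: field_simps)
  then have "Re (p z) = Re ((1 + w z) * cnj (1 - w z)) / (norm (1 - w z))\<^sup>2"
    by (simp add: complex_div_cnj[of "1 + w z"])
  also have "Re ((1 + w z) * cnj (1 - w z)) = 1 - (norm (w z))\<^sup>2"
    by (simp add: cmod_power2) (simp add: power2_eq_square algebra_simps)
  finally have eq: "Re (p z) = (1 - (norm (w z))\<^sup>2) / (norm (1 - w z))\<^sup>2" .
  have "(norm (1 - w z))\<^sup>2 \<le> (1 + norm (w z))\<^sup>2"
    using norm_triangle_ineq4[of 1 "w z"] by (intro power_mono) auto
  then have "(1 - (norm (w z))\<^sup>2) / (1 + norm (w z))\<^sup>2 \<le> Re (p z)"
    unfolding eq using w1 less[OF z]
    by (intro divide_left_mono) (auto simp: abs_square_le_1 add_nonneg_eq_0_iff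
        intro!: mult_pos_pos zero_less_power add_pos_nonneg)
  moreover have "(1 - (norm (w z))\<^sup>2) / (1 + norm (w z))\<^sup>2 = (1 - norm (w z)) / (1 + norm (w z))"
  proof -
    have "1 + norm (w z) \<noteq> 0" using norm_ge_zero[of "w z"] by linarith
    then show ?thesis
      by (simp add: divide_simps) (simp add: power2_eq_square algebra_simps)
  qed
  moreover have "(1 - norm z) / (1 + norm z) \<le> (1 - norm (w z)) / (1 + norm (w z))"
    using le z by (intro frac_le) (auto intro: add_pos_nonneg)
  ultimately show ?thesis by linarith
qed

lemma Re_convexity_quotient_ge:
  assumes p: "p holomorphic_on ball 0 1" and p0: "p 0 = 1"
    and gt: "\<And>z. z \<in> ball 0 1 \<Longrightarrow> Re (p z) > - 1 / 2" and z: "norm z < 1"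
  shows "(1 - 2 * norm z) / (1 + norm z) \<le> Re (p z)"
proof -
  have "(1 - norm z) / (1 + norm z) \<le> Re ((\<lambda>z. (1 + 2 * p z) / 3) z)"
  proof (rule Re_ge_of_Re_pos)
    show "(\<lambda>z. (1 + 2 * p z) / 3) holomorphic_on ball 0 1"
      by (intro holomorphic_intros p) auto
    show "0 < Re ((1 + 2 * p z) / 3)" if "z \<in> ball 0 1" for z
      using gt[OF that] by simp
  qed (use p0 z in auto)
  then have le: "(1 - norm z) / (1 + norm z) \<le> (1 + 2 * Re (p z)) / 3"
    by simp
  have "1 + norm z \<noteq> 0" using norm_ge_zero[of z] by linarith
  define k where "k = (1 - norm z) / (1 + norm z)"
  have eq: "(1 - 2 * norm z) / (1 + norm z) = (3 * k - 1) / 2"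
    using \<open>1 + norm z \<noteq> 0\<close> unfolding k_def
    by (simp add: divide_simps) (simp add: algebra_simps)
  show ?thesis using le unfolding eq k_def[symmetric] by simp
qed

section \<open>Curves with monotone tangent direction\<close>

text \<open>
  A closed curve whose tangent direction is \<open>\<i> * exp (L t)\<close> has outer normal \<open>exp (L t)\<close>.  If the
  argument of the normal increases by \<open>2\<pi>\<close> over one period, then the component of the curve
  along the normal at \<open>s\<close> has derivative of sign \<open>- sin\<close> of the angle turned since \<open>s\<close>: it
  falls while that angle is below \<open>\<pi>\<close> and rises afterwards, so it is largest at the two ends of
  the period.
\<close>

lemma turning_once_tangent_supports:
  fixes \<phi> L :: "real \<Rightarrow> complex"
  assumes der: "\<And>t. (\<phi> has_vector_derivative \<i> * exp (L t)) (at t)"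
    and mono: "mono (\<lambda>t. Im (L t))"
    and turn: "Im (L (s + 2*pi)) = Im (L s) + 2*pi"
    and per: "\<phi> (s + 2*pi) = \<phi> s"
    and t: "s \<le> t" "t \<le> s + 2*pi"
  shows "exp (L s) \<bullet> \<phi> t \<le> exp (L s) \<bullet> \<phi> s"
proof -
  define u where "u = (\<lambda>t. exp (L s) \<bullet> \<phi> t)"
  define \<alpha> where "\<alpha> = (\<lambda>t. Im (L t) - Im (L s))"
  have der_u: "(u has_real_derivative - exp (Re (L s) + Re (L t)) * sin (\<alpha> t)) (at t)" for t
  proof -
    have "(u has_vector_derivative exp (L s) \<bullet> (\<i> * exp (L t))) (at t)"
      unfolding u_def
      by (rule bounded_linear.has_vector_derivative[OF bounded_linear_inner_right der])
    moreover have "exp (L s) \<bullet> (\<i> * exp (L t)) = - exp (Re (L s) + Re (L t)) * sin (\<alpha> t)"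
      by (simp add: inner_complex_def Re_exp Im_exp \<alpha>_def sin_diff exp_add algebra_simps)
    ultimately show ?thesis
      by (simp add: has_real_derivative_iff_has_vector_derivative)
  qed
  have \<alpha>_mono: "\<alpha> x \<le> \<alpha> y" if "x \<le> y" for x y
    using monoD[OF mono that] by (simp add: \<alpha>_def)
  have \<alpha>0: "\<alpha> s = 0" and \<alpha>1: "\<alpha> (s + 2*pi) = 2*pi"
    using turn by (simp_all add: \<alpha>_def)
  have "u t \<le> u s"
  proof (cases "\<alpha> t \<le> pi")
    case True
    have "sin (\<alpha> x) \<ge> 0" if "s \<le> x" "x \<le> t" for x
      using \<alpha>_mono[OF that(1)] \<alpha>_mono[OF that(2)] True by (intro sin_ge_zero) (auto simp: \<alpha>0)
    then show ?thesis
      using der_u by (intro DERIV_nonpos_imp_nonincreasing[OF t(1)]) (fastforce)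
  next
    case False
    have "sin (\<alpha> x) \<le> 0" if "t \<le> x" "x \<le> s + 2*pi" for x
    proof -
      have "pi \<le> \<alpha> x" "\<alpha> x \<le> 2*pi"
        using \<alpha>_mono[OF that(1)] \<alpha>_mono[OF that(2)] False by (auto simp: \<alpha>1)
      then have "0 \<le> sin (\<alpha> x - pi)" by (intro sin_ge_zero) auto
      then show ?thesis by simp
    qed
    then have "u t \<le> u (s + 2*pi)"
      using der_u by (intro DERIV_nonneg_imp_nondecreasing[OF t(2)]) (fastforce simp: mult_nonneg_nonpos)
    then show ?thesis by (simp add: u_def per)
  qed
  then show ?thesis by (simp add: u_def)
qed

text \<open>
  After multiplication by \<open>|1 - q|\<^sup>2\<close> the quantity equals \<open>(1 - r\<^sup>2) Re P - r\<^sup>2 + Re q\<close>, since the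
  terms \<open>q cnj P\<close> and \<open>- cnj q P\<close> have opposite real parts.  As \<open>Re q \<ge> - r\<close>, it suffices that
  \<open>Re P \<ge> r / (1 - r)\<close>.  The assumed lower bound on \<open>Re P\<close> is at least \<open>r / (1 - r)\<close> exactly when
  the quadratic is nonnegative, and this is how \<open>2 - sqrt 3\<close>, its smaller root, arises.
\<close>

lemma turning_rate_nonneg:
  fixes P q :: complex and r :: real
  assumes r: "0 < r" "r < 1" "0 \<le> 1 - 4*r + r\<^sup>2" and q: "norm q = r"
    and P: "(1 - 2*r) / (1 + r) \<le> Re P"
  shows "0 \<le> Re ((P + q * (1 + cnj P)) / (1 - q))"
proof -
  have "r / (1 - r) \<le> (1 - 2*r) / (1 + r)"
    using r by (simp add: divide_simps) (simp add: power2_eq_square algebra_simps)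
  then have "r / (1 - r) \<le> Re P" using P by linarith
  then have "0 \<le> (1 + r) * ((1 - r) * Re P - r)"
    using r by (intro mult_nonneg_nonneg) (auto simp: divide_simps mult.commute)
  also have "\<dots> = Re P - r\<^sup>2 * (1 + Re P) - r"
    by (simp add: power2_eq_square algebra_simps)
  also have "\<dots> \<le> Re P - r\<^sup>2 * (1 + Re P) + Re q"
    using abs_Re_le_cmod[of q] q by linarith
  also have "\<dots> = Re ((P + q * (1 + cnj P)) * cnj (1 - q))"
    unfolding q[symmetric] by (simp add: cmod_power2) (simp add: power2_eq_square algebra_simps)
  finally show ?thesis
    by (simp add: complex_div_cnj[of _ "1 - q"])
qed

section \<open>Convexity of images of small disks\<close>

text \<open>
  With \<open>z = r exp (\<i> t)\<close>, the curve \<open>\<phi> t = h z + cnj (g z)\<close> has derivative \<open>\<i> * n\<close>, where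
  \<open>n = A (1 - q)\<close>, \<open>A = z h' z\<close> and \<open>q = cnj (z A) / A\<close>; here \<open>g' = z h'\<close> gives the second
  term.  As \<open>h'\<close> has a holomorphic logarithm \<open>H\<close> and \<open>|q| = r < 1\<close>, the normal has the continuous
  logarithm \<open>L t = ln r + \<i> t + H z + Ln (1 - q)\<close>.  Only the summand \<open>\<i> t\<close> fails to be periodic,
  so the normal turns exactly once.  Its rate of turning is \<open>Re ((P + q (1 + cnj P)) / (1 - q))\<close> with
  \<open>P = 1 + z h'' / h'\<close>, which is nonnegative.
\<close>

lemma normal_supports_circle_image:
  assumes h: "h holomorphic_on ball 0 1" and g: "g holomorphic_on ball 0 1"
    and dg: "\<And>z. z \<in> ball 0 1 \<Longrightarrow> deriv g z = z * deriv h z"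
    and h'0: "\<And>z. z \<in> ball 0 1 \<Longrightarrow> deriv h z \<noteq> 0"
    and gt: "\<And>z. z \<in> ball 0 1 \<Longrightarrow> Re (1 + z * deriv (deriv h) z / deriv h z) > - 1 / 2"
    and r: "0 < r" "r < 1" "0 \<le> 1 - 4*r + r\<^sup>2"
    and z: "norm z = r" and y: "norm y = r"
  defines "n \<equiv> z * deriv h z - cnj (z\<^sup>2 * deriv h z)"
  shows "n \<noteq> 0 \<and> n \<bullet> (h y + cnj (g y)) \<le> n \<bullet> (h z + cnj (g z))"
proof -
  have h': "deriv h holomorphic_on ball 0 1"
    using h by (rule holomorphic_deriv) simp
  have zero: "(0::complex) \<in> ball 0 1" by simp
  obtain H where H: "H holomorphic_on ball 0 1"
    and expH: "\<And>z. z \<in> ball 0 1 \<Longrightarrow> exp (H z) = deriv h z"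
    using holomorphic_logarithm_exists[OF convex_ball open_ball h' h'0 zero] by metis
  define P where "P = (\<lambda>z. 1 + z * deriv H z)"
  have derH: "(H has_field_derivative deriv H z) (at z)" if "z \<in> ball 0 1" for z
    using holomorphic_derivI[OF H open_ball that] .
  have P: "P z = 1 + z * deriv (deriv h) z / deriv h z" if "z \<in> ball 0 1" for z
  proof -
    have "((\<lambda>z. exp (H z)) has_field_derivative exp (H z) * deriv H z) (at z)"
      by (intro derivative_intros derH that)
    then have "(deriv h has_field_derivative exp (H z) * deriv H z) (at z)"
      by (rule has_field_derivative_transform_within_open[OF _ open_ball that]) (simp add: expH)
    then have "deriv (deriv h) z = deriv h z * deriv H z"
      using expH[OF that] by (simp add: DERIV_imp_deriv)
    then show ?thesis
      using h'0[OF that] by (simp add: P_def)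
  qed
  have P_ge: "(1 - 2*r) / (1 + r) \<le> Re (P w)" if "norm w = r" for w
  proof -
    have "P holomorphic_on ball 0 1"
      unfolding P_def by (intro holomorphic_intros holomorphic_deriv[OF H]) auto
    moreover have "P 0 = 1" by (simp add: P_def)
    ultimately have "(1 - 2 * norm w) / (1 + norm w) \<le> Re (P w)"
      using gt P r that by (intro Re_convexity_quotient_ge) auto
    then show ?thesis using that by simp
  qed
  \<comment> \<open>\<open>G\<close> below is a logarithm of \<open>z h' z\<close> along the circle, and \<open>q\<close> is written as an exponential so
    that its derivative follows from those of \<open>l\<close> and \<open>G\<close>.\<close>
  define l where "l = (\<lambda>t::real. of_real (ln r) + \<i> * of_real t)"
  define Z where "Z = (\<lambda>t. exp (l t))"
  have Z: "Z t = of_real r * exp (\<i> * of_real t)" for t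
    using r by (simp add: Z_def l_def exp_add exp_of_real)
  have normZ: "norm (Z t) = r" for t
    using r by (simp add: Z norm_mult)
  have Zball: "Z t \<in> ball 0 1" for t
    using normZ r by simp
  have Zper: "Z (t + 2*pi) = Z t" for t
  proof -
    have "exp (\<i> * of_real (t + 2*pi)) = exp (\<i> * of_real t) * exp (2 * of_real pi * \<i>)"
      unfolding exp_add[symmetric] by (rule arg_cong[of _ _ exp]) (simp add: algebra_simps)
    then show ?thesis by (simp add: Z)
  qed
  have derl: "(l has_vector_derivative \<i>) (at t)" for t
  proof -
    have "((\<lambda>t. of_real (ln r) + \<i> * of_real t) has_vector_derivative (0 + \<i> * of_real 1)) (at t)"
      by (intro derivative_intros)
    then show ?thesis by (simp add: l_def)
  qed
  have derZ: "(Z has_vector_derivative \<i> * Z t) (at t)" for t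
    using field_vector_diff_chain_at[OF derl DERIV_exp] by (simp add: Z_def o_def)
  have chain: "((\<lambda>t. F (Z t)) has_vector_derivative \<i> * (Z t * F')) (at t)"
    if "(F has_field_derivative F') (at (Z t))" for F F' t
    using field_vector_diff_chain_at[OF derZ that] by (simp add: o_def mult_ac)

  define G where "G = (\<lambda>t. l t + H (Z t))"
  define q where "q = (\<lambda>t. exp (cnj (l t) + cnj (G t) - G t))"
  define L where "L = (\<lambda>t. G t + Ln (1 - q t))"
  define \<phi> where "\<phi> = (\<lambda>t. h (Z t) + cnj (g (Z t)))"

  have normq: "norm (q t) = r" for t
    using r by (simp add: q_def l_def)
  have q1: "0 < Re (1 - q t)" for t
    using complex_Re_le_cmod[of "q t"] normq[of t] r by simp
  have expG: "exp (G t) = Z t * deriv h (Z t)" for t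
    using expH[OF Zball, of t] by (simp add: G_def exp_add Z_def)
  have expL: "exp (L t) = Z t * deriv h (Z t) - cnj ((Z t)\<^sup>2 * deriv h (Z t))" for t
  proof -
    have "1 - q t \<noteq> 0" using q1[of t] by auto
    then have "exp (L t) = exp (G t) * (1 - q t)"
      by (simp add: L_def exp_add)
    also have "\<dots> = exp (G t) - cnj (Z t) * cnj (exp (G t))"
      by (simp add: q_def Z_def exp_add exp_diff exp_cnj right_diff_distrib)
    finally show ?thesis
      by (simp add: expG power2_eq_square)
  qed
  have der\<phi>: "(\<phi> has_vector_derivative \<i> * exp (L t)) (at t)" for t
  proof -
    have "(\<phi> has_vector_derivative
        \<i> * (Z t * deriv h (Z t)) + cnj (\<i> * (Z t * deriv g (Z t)))) (at t)"
      unfolding \<phi>_def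
      using chain[OF holomorphic_derivI[OF h open_ball Zball]]
        chain[OF holomorphic_derivI[OF g open_ball Zball]]
      by (intro has_vector_derivative_add has_vector_derivative_cnj)
    also have "\<i> * (Z t * deriv h (Z t)) + cnj (\<i> * (Z t * deriv g (Z t))) = \<i> * exp (L t)"
      by (simp add: expL dg[OF Zball] power2_eq_square algebra_simps)
    finally show ?thesis .
  qed
  have derL: "(L has_vector_derivative
      \<i> * ((P (Z t) + q t * (1 + cnj (P (Z t)))) / (1 - q t))) (at t)" for t
  proof -
    let ?P = "P (Z t)"
    have "(G has_vector_derivative \<i> + \<i> * (Z t * deriv H (Z t))) (at t)"
      unfolding G_def by (intro has_vector_derivative_add derl chain derH Zball)
    then have dG: "(G has_vector_derivative \<i> * ?P) (at t)"
      by (simp add: P_def algebra_simps)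
    have "((\<lambda>t. cnj (l t) + cnj (G t) - G t) has_vector_derivative
        cnj \<i> + cnj (\<i> * ?P) - \<i> * ?P) (at t)"
      by (intro has_vector_derivative_add has_vector_derivative_diff has_vector_derivative_cnj derl dG)
    from field_vector_diff_chain_at[OF this DERIV_exp]
    have "(q has_vector_derivative (cnj \<i> + cnj (\<i> * ?P) - \<i> * ?P) * q t) (at t)"
      by (simp add: q_def o_def)
    then have "((\<lambda>t. 1 - q t) has_vector_derivative
        0 - (cnj \<i> + cnj (\<i> * ?P) - \<i> * ?P) * q t) (at t)"
      by (intro has_vector_derivative_diff has_vector_derivative_const)
    moreover have "1 - q t \<notin> \<real>\<^sub>\<le>\<^sub>0"
      using q1[of t] by (auto simp: complex_nonpos_Reals_iff)
    ultimately have "((Ln \<circ> (\<lambda>t. 1 - q t)) has_vector_derivative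
        (0 - (cnj \<i> + cnj (\<i> * ?P) - \<i> * ?P) * q t) * inverse (1 - q t)) (at t)"
      by (intro field_vector_diff_chain_at has_field_derivative_Ln)
    from has_vector_derivative_add[OF dG this]
    have "(L has_vector_derivative \<i> * ?P +
        (0 - (cnj \<i> + cnj (\<i> * ?P) - \<i> * ?P) * q t) * inverse (1 - q t)) (at t)"
      by (simp add: L_def o_def)
    also have "\<i> * ?P + (0 - (cnj \<i> + cnj (\<i> * ?P) - \<i> * ?P) * q t) * inverse (1 - q t)
        = \<i> * ((?P + q t * (1 + cnj ?P)) / (1 - q t))"
    proof -
      have "1 - q t \<noteq> 0" using q1[of t] by auto
      then show ?thesis by (simp add: divide_simps) (simp add: algebra_simps)
    qed
    finally show ?thesis .
  qed
  have derIm: "((\<lambda>t. Im (L t)) has_real_derivative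
      Re ((P (Z t) + q t * (1 + cnj (P (Z t)))) / (1 - q t))) (at t)" for t
    using derL[of t] by (simp add: has_vector_derivative_complex_iff del: times_divide_eq_right)
  have mono: "mono (\<lambda>t. Im (L t))"
  proof (rule monoI, rule DERIV_nonneg_imp_nondecreasing[where f = "\<lambda>t. Im (L t)"])
    show "\<exists>d. ((\<lambda>t. Im (L t)) has_real_derivative d) (at t) \<and> 0 \<le> d" for t
      by (intro exI conjI, rule derIm, rule turning_rate_nonneg[OF r normq P_ge[OF normZ]])
  qed
  have turn: "Im (L (t + 2*pi)) = Im (L t) + 2*pi" for t
  proof -
    have "G (t + 2*pi) = G t + 2 * pi * \<i>"
      unfolding G_def Zper by (simp add: l_def algebra_simps)
    moreover have "q (t + 2*pi) = q t"
    proof -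
      have "q t = cnj (Z t) * cnj (exp (G t)) / exp (G t)" for t
        by (simp add: q_def Z_def exp_diff exp_add exp_cnj)
      then show ?thesis by (simp add: expG Zper)
    qed
    ultimately show ?thesis by (simp add: L_def)
  qed
  have per: "\<phi> (t + 2*pi) = \<phi> t" for t
    by (simp add: \<phi>_def Zper)

  \<comment> \<open>Parameters of the two points, with the second at most one turn after the first.\<close>
  define s where "s = Arg2pi (z / of_real r)"
  define a where "a = Arg2pi (y / z)"
  have z0: "z \<noteq> 0" using z r by auto
  have Zs: "Z s = z"
    using complex_norm_eq_1_exp[of "z / of_real r"] z r by (simp add: Z s_def norm_divide)
  have "exp (\<i> * of_real a) = y / z"
    using complex_norm_eq_1_exp[of "y / z"] z y r by (simp add: a_def norm_divide)
  then have Zt: "Z (s + a) = y"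
  proof -
    have "exp (\<i> * of_real (s + a)) = exp (\<i> * of_real s) * exp (\<i> * of_real a)"
      unfolding exp_add[symmetric] by (rule arg_cong[of _ _ exp]) (simp add: algebra_simps)
    then show ?thesis
      using Zs z0 \<open>exp (\<i> * of_real a) = y / z\<close> by (simp add: Z flip: mult.assoc)
  qed
  have "exp (L s) \<bullet> \<phi> (s + a) \<le> exp (L s) \<bullet> \<phi> s"
    using Arg2pi_ge_0[of "y / z"] Arg2pi_lt_2pi[of "y / z"]
    by (intro turning_once_tangent_supports[OF der\<phi> mono turn per]) (auto simp: a_def)
  moreover have "exp (L s) = n"
    by (simp add: expL Zs n_def)
  ultimately show ?thesis
    using exp_not_eq_zero[of "L s"] by (simp add: \<phi>_def Zs Zt)
qed

text \<open>
  The support property on the circle extends to the disk by the maximum principle: the component of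
  \<open>h + cnj g\<close> along a fixed \<open>n\<close> is the real part of the holomorphic function \<open>cnj n * h + n * g\<close>.
\<close>

lemma convex_domain_image_small_disk:
  assumes h: "h holomorphic_on ball 0 1" and g: "g holomorphic_on ball 0 1"
    and dg: "\<And>z. z \<in> ball 0 1 \<Longrightarrow> deriv g z = z * deriv h z"
    and h'0: "\<And>z. z \<in> ball 0 1 \<Longrightarrow> deriv h z \<noteq> 0"
    and gt: "\<And>z. z \<in> ball 0 1 \<Longrightarrow> Re (1 + z * deriv (deriv h) z / deriv h z) > - 1 / 2"
    and r: "0 < r" "r < 1" "0 \<le> 1 - 4*r + r\<^sup>2"
  shows "convex_domain ((\<lambda>z. h z + cnj (g z)) ` ball 0 r)"
proof -
  let ?f = "\<lambda>z. h z + cnj (g z)"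
  have sub: "cball 0 r \<subseteq> ball 0 1" "ball 0 r \<subseteq> ball 0 1"
    using r by auto
  have conth: "continuous_on (cball 0 r) h" and contg: "continuous_on (cball 0 r) g"
    using h g sub by (meson continuous_on_subset holomorphic_on_imp_continuous_on)+
  then have cont: "continuous_on (cball 0 r) ?f"
    by (intro continuous_intros)
  have holb: "h holomorphic_on ball 0 r" "g holomorphic_on ball 0 r"
    using h g sub by (meson holomorphic_on_subset)+
  have opn: "open (?f ` ball 0 r)"
  proof (rule open_image_sense_preserving_harmonic[OF open_ball holb])
    fix z :: complex assume "z \<in> ball 0 r"
    then have z: "z \<in> ball 0 1" "norm z < 1" using r by auto
    then show "norm (deriv g z) < norm (deriv h z)"
      using h'0[OF z(1)] by (simp add: dg norm_mult mult_less_cancel_right1)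
  qed
  have "convex (?f ` ball 0 r)"
  proof (rule convex_image_if_support_planes[OF r(1) cont opn])
    fix z :: complex assume "z \<in> sphere 0 r"
    then have z: "norm z = r" by simp
    define n where "n = z * deriv h z - cnj (z\<^sup>2 * deriv h z)"
    define F where "F = (\<lambda>y. cnj n * h y + n * g y)"
    have F: "Re (F y) = n \<bullet> ?f y" for y
      by (simp add: F_def inner_complex_def algebra_simps)
    have circ: "n \<noteq> 0 \<and> n \<bullet> ?f y \<le> n \<bullet> ?f z" if "norm y = r" for y
      unfolding n_def using normal_supports_circle_image[OF h g dg h'0 gt r z that] .
    have "Re (F y) \<le> n \<bullet> ?f z" if "y \<in> ball 0 r" for y
    proof (rule maximum_real_frontier[OF _ _ _ _ that])
      show "F holomorphic_on interior (ball 0 r)"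
        unfolding F_def by (auto intro!: holomorphic_intros holb)
      show "continuous_on (closure (ball 0 r)) F"
        unfolding F_def using r by (auto intro!: continuous_intros conth contg)
      show "Re (F w) \<le> n \<bullet> ?f z" if "w \<in> frontier (ball 0 r)" for w
        using circ[of w] that r by (simp add: F)
    qed simp
    then show "\<exists>n. n \<noteq> 0 \<and> (\<forall>y\<in>ball 0 r. n \<bullet> ?f y \<le> n \<bullet> ?f z)"
      using circ[OF z] by (intro exI[of _ n]) (auto simp: F)
  qed
  then show ?thesis
    unfolding convex_domain_def using opn r by (auto simp: convex_connected)
qed

section \<open>An extremal function\<close>

text \<open>
  The function with \<open>h' z = 1 / (1 - z) ^ 3\<close>, for which \<open>1 + z h'' / h' = (1 + 2 z) / (1 - z)\<close> maps
  the unit disk onto the half-plane \<open>Re > - 1 / 2\<close>.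
\<close>

definition extremal_h :: "complex \<Rightarrow> complex" where
  "extremal_h z = (1 / (1 - z)\<^sup>2 - 1) / 2"

text \<open>
  The primitive of \<open>z / (1 - z) ^ 3\<close> that vanishes at \<open>0\<close>.
\<close>

definition extremal_g :: "complex \<Rightarrow> complex" where
  "extremal_g z = (1 / (1 - z)\<^sup>2 + 1) / 2 - 1 / (1 - z)"

lemma sums_Taylor_tail:
  assumes f: "f holomorphic_on ball 0 1" and "f 0 = 0" and z: "z \<in> ball 0 1"
  shows "(\<lambda>n. (deriv ^^ (n + 1)) f 0 / fact (n + 1) * z ^ (n + 1)) sums f z"
proof -
  have "(\<lambda>n. (deriv ^^ n) f 0 / fact n * z ^ n) sums f z"
    using holomorphic_power_series[OF f z] by simp
  then show ?thesis
    using \<open>f 0 = 0\<close> sums_Suc_iff[of "\<lambda>n. (deriv ^^ n) f 0 / fact n * z ^ n" "f z"] by simp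
qed

lemma extremal_in_class_M1: "(\<lambda>z. extremal_h z + cnj (extremal_g z)) \<in> class_M1"
proof -
  have nz: "1 - z \<noteq> 0" if "z \<in> ball 0 1" for z :: complex
    using that by auto
  have dh: "(extremal_h has_field_derivative 1 / (1 - z) ^ 3) (at z)" if "z \<in> ball 0 1" for z
    unfolding extremal_h_def [abs_def] using nz[OF that]
    by (auto intro!: derivative_eq_intros) (simp add: divide_simps power_numeral_reduce)
  have dg: "(extremal_g has_field_derivative z / (1 - z) ^ 3) (at z)" if "z \<in> ball 0 1" for z
    unfolding extremal_g_def [abs_def] using nz[OF that]
    by (auto intro!: derivative_eq_intros)
      (simp add: divide_simps power_numeral_reduce, simp add: algebra_simps)
  have h: "extremal_h holomorphic_on ball 0 1" and g: "extremal_g holomorphic_on ball 0 1"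
    using dh dg by (meson holomorphic_on_open open_ball)+
  have h': "deriv extremal_h z = 1 / (1 - z) ^ 3" if "z \<in> ball 0 1" for z
    using dh[OF that] by (rule DERIV_imp_deriv)
  have g': "deriv extremal_g z = z / (1 - z) ^ 3" if "z \<in> ball 0 1" for z
    using dg[OF that] by (rule DERIV_imp_deriv)
  have h'': "deriv (deriv extremal_h) z = 3 / (1 - z) ^ 4" if "z \<in> ball 0 1" for z
  proof -
    have "((\<lambda>z. 1 / (1 - z) ^ 3) has_field_derivative 3 / (1 - z) ^ 4) (at z)"
      using nz[OF that]
      by (auto intro!: derivative_eq_intros) (simp add: divide_simps power_numeral_reduce)
    then have "(deriv extremal_h has_field_derivative 3 / (1 - z) ^ 4) (at z)"
      by (rule has_field_derivative_transform_within_open[OF _ open_ball that]) (simp add: h')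
    then show ?thesis by (rule DERIV_imp_deriv)
  qed
  have quot: "Re (1 + z * deriv (deriv extremal_h) z / deriv extremal_h z) > - 1 / 2"
    if z: "z \<in> ball 0 1" for z
  proof -
    have lin: "Re (- 1 / 2 + 3 / 2 * w) = - 1 / 2 + 3 / 2 * Re w" for w
      by simp
    have "1 + z * deriv (deriv extremal_h) z / deriv extremal_h z = (1 + 2 * z) / (1 - z)"
      using nz[OF z] by (simp add: h'[OF z] h''[OF z] divide_simps) (simp add: power_numeral_reduce algebra_simps)
    also have "\<dots> = - 1 / 2 + 3 / 2 * ((1 + z) / (1 - z))"
      using nz[OF z] by (simp add: divide_simps) (simp add: algebra_simps)
    finally have eq: "Re (1 + z * deriv (deriv extremal_h) z / deriv extremal_h z)
        = - 1 / 2 + 3 / 2 * Re ((1 + z) / (1 - z))" 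
      by (simp only: lin)
    have "(norm z)\<^sup>2 < 1" using z by (simp add: abs_square_less_1)
    then have "0 < Re ((1 + z) * cnj (1 - z))"
      by (simp add: cmod_power2 algebra_simps) (simp add: power2_eq_square)
    then have "0 < Re ((1 + z) / (1 - z))"
      using nz[OF z] by (simp add: complex_div_cnj[of _ "1 - z"])
    then show ?thesis unfolding eq by simp
  qed
  define a where "a = (\<lambda>n. (deriv ^^ n) extremal_h 0 / fact n)"
  define b where "b = (\<lambda>n. (deriv ^^ n) extremal_g 0 / fact n)"
  have serg: "(\<lambda>n. b (n + 1) * z ^ (n + 1)) sums extremal_g z" if "z \<in> ball 0 1" for z
    unfolding b_def using sums_Taylor_tail[OF g _ that] by (simp add: extremal_g_def)
  have serh: "(\<lambda>n. a (n + 2) * z ^ (n + 2)) sums (extremal_h z - z)" if "z \<in> ball 0 1" for z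
  proof -
    have "(\<lambda>n. a (n + 1) * z ^ (n + 1)) sums extremal_h z"
      unfolding a_def using sums_Taylor_tail[OF h _ that] by (simp add: extremal_h_def)
    moreover have "a 1 = 1" by (simp add: a_def h')
    ultimately show ?thesis
      using sums_Suc_iff[of "\<lambda>n. a (n + 1) * z ^ (n + 1)" "extremal_h z - z"] by simp
  qed
  show ?thesis
    unfolding class_M1_def mem_Collect_eq
    using h g serh serg quot nz
    by (intro exI[of _ extremal_h] exI[of _ extremal_g] exI[of _ a] exI[of _ b])
      (auto simp: h' g')
qed

text \<open>
  Since \<open>h z + g z\<close> is the Koebe function \<open>z / (1 - z)\<^sup>2\<close> and \<open>h z - g z = z / (1 - z)\<close>, the
  coordinate \<open>u = 1 / (1 - z)\<close> turns the real part into a quadratic and the imaginary part into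
  \<open>Im u\<close>.
\<close>

lemma extremal_Re_Im:
  assumes "u \<noteq> 0"
  shows "extremal_h (1 - 1 / u) + cnj (extremal_g (1 - 1 / u)) = Complex (Re (u\<^sup>2 - u)) (Im u)"
  using assms by (simp add: extremal_h_def extremal_g_def complex_eq_iff power_divide power2_eq_square field_simps)

lemma norm_one_minus_inverse_less_iff:
  assumes "u \<noteq> 0" "0 < r"
  shows "1 - 1 / u \<in> ball 0 r \<longleftrightarrow> (Re u - 1)\<^sup>2 + (Im u)\<^sup>2 < r\<^sup>2 * ((Re u)\<^sup>2 + (Im u)\<^sup>2)"
proof -
  have "1 - 1 / u = (u - 1) / u" using assms by (simp add: field_simps)
  then have "1 - 1 / u \<in> ball 0 r \<longleftrightarrow> norm (u - 1) < r * norm u"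
    using assms by (simp add: norm_divide divide_less_eq)
  also have "\<dots> \<longleftrightarrow> (norm (u - 1))\<^sup>2 < (r * norm u)\<^sup>2"
    using assms power_mono_iff[of "r * norm u" "norm (u - 1)" 2] by (simp flip: not_le)
  finally show ?thesis
    by (simp add: cmod_power2 power_mult_distrib)
qed

text \<open>
  In the coordinate \<open>u = 1 / (1 - z)\<close> the disk \<open>|z| < r\<close> becomes the disk with diameter
  \<open>(1 / (1 + r), 1 / (1 - r))\<close> on the real axis, and the function is real only for real \<open>u\<close>.
  There it increases, so its real values all exceed its value \<open>x\<close> at the left end \<open>a0 = 1 / (1 + r)\<close>.
  But past the critical radius the boundary is dented at \<open>a0\<close>: there are conjugate points
  \<open>a + \<i> b\<close> and \<open>a - \<i> b\<close> inside the disk whose images have real part equal to \<open>x\<close>.  The midpoint of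
  these images is the real number \<open>x\<close>, which is not in the image.
\<close>

lemma extremal_image_not_convex:
  assumes r: "0 < r" "r < 1" "1 - 4*r + r\<^sup>2 < 0"
  shows "\<not> convex ((\<lambda>z. extremal_h z + cnj (extremal_g z)) ` ball 0 r)"
proof
  let ?f = "\<lambda>z. extremal_h z + cnj (extremal_g z)"
  assume conv: "convex (?f ` ball 0 r)"
  define a0 where "a0 = 1 / (1 + r)"
  \<comment> \<open>For \<open>a = a0 + \<delta>\<close>, the choice of \<open>b\<close> gives the image the real part \<open>x\<close>.  The point
    then lies in the disk iff \<open>(1 - r) (3 a0 - 1 + 2 \<delta>) < 1\<close>, and this \<open>\<delta>\<close> closes half of the gap
    left at \<open>\<delta> = 0\<close>.\<close>
  define \<delta> where "\<delta> = (1 / (1 - r) + 1 - 3 * a0) / 4"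
  define a where "a = a0 + \<delta>"
  define b where "b = sqrt (\<delta> * (2 * a0 - 1 + \<delta>))"
  define x where "x = a0\<^sup>2 - a0"
  have a0: "(1 + r) * a0 = 1" "1 / 2 < a0"
    using r by (simp_all add: a0_def field_simps)
  have gap: "(1 - r) * (3 * a0 - 1) < 1"
    using r unfolding a0_def by (simp add: divide_simps) (simp add: power2_eq_square algebra_simps)
  have \<delta>eq: "(1 - r) * (4 * \<delta>) = 1 - (1 - r) * (3 * a0 - 1)"
    using r by (simp add: \<delta>_def field_simps)
  have \<delta>: "0 < \<delta>"
  proof -
    have "0 < (1 - r) * (4 * \<delta>)" unfolding \<delta>eq using gap by simp
    then show ?thesis using r by (simp add: zero_less_mult_iff)
  qed
  have b2: "b\<^sup>2 = \<delta> * (2 * a0 - 1 + \<delta>)"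
    unfolding b_def using \<delta> a0 by (intro real_sqrt_pow2) auto
  have bd: "(a - 1)\<^sup>2 + b\<^sup>2 < r\<^sup>2 * (a\<^sup>2 + b\<^sup>2)"
  proof -
    have "(1 - r) * (2 * a0 - 1 + \<delta>) < 1 - (1 - r) * a"
      using \<delta>eq gap unfolding a_def by (simp add: algebra_simps)
    then have "((1 + r) * \<delta>) * ((1 - r) * (2 * a0 - 1 + \<delta>)) < ((1 + r) * \<delta>) * (1 - (1 - r) * a)"
      using r \<delta> by (intro mult_strict_left_mono) auto
    moreover have "(1 + r) * \<delta> = (1 + r) * a - 1"
      using a0 by (simp add: a_def ring_distribs)
    moreover have "(1 + r) * (1 - r) * b\<^sup>2 = ((1 + r) * \<delta>) * ((1 - r) * (2 * a0 - 1 + \<delta>))"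
      by (simp add: b2 mult_ac)
    ultimately have "(1 + r) * (1 - r) * b\<^sup>2 < ((1 + r) * a - 1) * (1 - (1 - r) * a)"
      by (simp only:)
    then show ?thesis
      by (simp add: power2_eq_square algebra_simps)
  qed
  have image: "Complex x y \<in> ?f ` ball 0 r" if "y\<^sup>2 = b\<^sup>2" for y
  proof -
    define u where "u = Complex a y"
    have u0: "u \<noteq> 0" using a0 \<delta> by (auto simp: u_def a_def complex_eq_iff)
    have "1 - 1 / u \<in> ball 0 r"
      using bd that norm_one_minus_inverse_less_iff[OF u0 r(1)] by (simp add: u_def)
    moreover have "Re (u\<^sup>2 - u) = x"
      using that b2 by (simp add: u_def x_def a_def power2_eq_square) (simp add: algebra_simps)
    ultimately show ?thesis
      using extremal_Re_Im[OF u0] by (intro image_eqI[of _ _ "1 - 1 / u"]) (simp_all add: u_def)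
  qed
  have "(1/2) *\<^sub>R Complex x b + (1/2) *\<^sub>R Complex x (- b) \<in> ?f ` ball 0 r"
    by (rule convexD[OF conv]) (auto intro: image)
  then obtain z where z: "z \<in> ball 0 r" and fz: "?f z = Complex x 0"
    by (auto simp: complex_eq_iff)
  define u where "u = 1 / (1 - z)"
  have "1 - z \<noteq> 0" using z r by auto
  then have u0: "u \<noteq> 0" and zu: "z = 1 - 1 / u" by (simp_all add: u_def)
  have "Complex (Re (u\<^sup>2 - u)) (Im u) = Complex x 0"
    using fz unfolding zu extremal_Re_Im[OF u0] .
  then have im: "Im u = 0" and re: "(Re u)\<^sup>2 - Re u = x"
    by (auto simp: power2_eq_square)
  have "(Re u - 1)\<^sup>2 < r\<^sup>2 * (Re u)\<^sup>2"
    using z norm_one_minus_inverse_less_iff[OF u0 r(1)] by (simp add: zu im)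
  then have pos: "0 < ((1 + r) * Re u - 1) * (1 - (1 - r) * Re u)"
    by (simp add: power2_eq_square algebra_simps)
  have "a0 < Re u"
  proof (rule ccontr)
    assume "\<not> a0 < Re u"
    then have le: "Re u \<le> a0" by simp
    then have "(1 + r) * Re u \<le> (1 + r) * a0" using r by simp
    moreover have "(1 - r) * Re u \<le> (1 - r) * a0" using le r by simp
    moreover have "(1 - r) * a0 < (1 + r) * a0"
      using r a0 by (intro mult_strict_right_mono) auto
    ultimately show False
      using pos a0(1) by (auto simp: zero_less_mult_iff)
  qed
  then have "0 < (Re u - a0) * (Re u + a0 - 1)"
    using a0 by (intro mult_pos_pos) auto
  then show False
    using re by (simp add: x_def power2_eq_square algebra_simps)
qed

section \<open>The critical radius\<close>

lemma sqrt3_quadratic: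
  shows "0 < r \<Longrightarrow> r \<le> 2 - sqrt 3 \<Longrightarrow> r < 1 \<and> 0 \<le> 1 - 4*r + r\<^sup>2"
    and "2 - sqrt 3 < r \<Longrightarrow> r < 1 \<Longrightarrow> 0 < r \<and> 1 - 4*r + r\<^sup>2 < 0"
proof -
  have s: "1 < sqrt 3" "sqrt 3 < 2" "(sqrt 3)\<^sup>2 = (3::real)"
    by (auto simp: real_less_lsqrt)
  have fac: "1 - 4*r + r\<^sup>2 = ((2 - sqrt 3) - r) * ((2 + sqrt 3) - r)"
    using s(3) by (simp add: power2_eq_square algebra_simps)
  show "r < 1 \<and> 0 \<le> 1 - 4*r + r\<^sup>2" if "0 < r" "r \<le> 2 - sqrt 3"
    unfolding fac using s that by (intro conjI mult_nonneg_nonneg; linarith)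
  show "0 < r \<and> 1 - 4*r + r\<^sup>2 < 0" if "2 - sqrt 3 < r" "r < 1"
    unfolding fac using s that by (intro conjI mult_neg_pos; linarith)
qed

lemma not_convexity_bound_class_M1:
  assumes "2 - sqrt 3 < \<rho>"
  shows "\<not> convexity_bound class_M1 \<rho>"
proof
  assume bound: "convexity_bound class_M1 \<rho>"
  have "2 - sqrt 3 < min \<rho> 1"
    using assms by (auto simp: real_less_rsqrt)
  then obtain r where r: "2 - sqrt 3 < r" "r < min \<rho> 1"
    using dense by blast
  then have r': "0 < r" "r < 1" "1 - 4*r + r\<^sup>2 < 0"
    using sqrt3_quadratic(2)[of r] by auto
  then have "convex_domain ((\<lambda>z. extremal_h z + cnj (extremal_g z)) ` ball 0 r)"
    using bound extremal_in_class_M1 r by (simp add: convexity_bound_def)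
  then show False
    using extremal_image_not_convex[OF r'] by (simp add: convex_domain_def)
qed

theorem theorem3p7:
  shows "is_radius_of_convexity class_M1 (2 - sqrt 3) \<and>
         (\<forall>\<rho>. 2 - sqrt 3 < \<rho> \<longrightarrow> \<not> convexity_bound class_M1 \<rho>)"
proof -
  have "convexity_bound class_M1 (2 - sqrt 3)"
    unfolding convexity_bound_def
  proof (intro conjI allI impI ballI)
    show "0 < 2 - sqrt (3::real)" "2 - sqrt (3::real) \<le> 1"
      by (auto simp: real_less_lsqrt)
    fix r f assume r: "0 < r \<and> r \<le> 2 - sqrt 3" and f: "f \<in> class_M1"
    have r': "0 < r" "r < 1" "0 \<le> 1 - 4*r + r\<^sup>2"
      using r sqrt3_quadratic(1)[of r] by auto
    from f obtain h g and a b :: "nat \<Rightarrow> complex"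
      where hg: "h holomorphic_on ball 0 1" "g holomorphic_on ball 0 1"
      and pt: "\<forall>z\<in>ball 0 1. f z = h z + cnj (g z) \<and>
        (\<lambda>n. a (n + 2) * z ^ (n + 2)) sums (h z - z) \<and>
        (\<lambda>n. b (n + 1) * z ^ (n + 1)) sums g z \<and>
        deriv g z = z * deriv h z \<and> deriv h z \<noteq> 0 \<and>
        Re (1 + z * deriv (deriv h) z / deriv h z) > - 1 / 2"
      unfolding class_M1_def by (elim CollectE exE conjE) (rule that)
    have "convex_domain ((\<lambda>z. h z + cnj (g z)) ` ball 0 r)"
      using pt by (intro convex_domain_image_small_disk[OF hg _ _ _ r']) auto
    also have "(\<lambda>z. h z + cnj (g z)) ` ball 0 r = f ` ball 0 r"
      using pt r' by (intro image_cong refl) auto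
    finally show "convex_domain (f ` ball 0 r)" .
  qed
  then show ?thesis
    using not_convexity_bound_class_M1 unfolding is_radius_of_convexity_def
    by (meson not_le)
qed

end
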